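(* Assume $f_1,f_2\in C^1(\mathbb R)$, $f_i(0)=0$, that for $i=1,2$ there is $K_i>0$ with $f_i\le 0$ on $[K_i,+\infty)$, and that the functions $s\mapsto f_i(s)/s$ are non-increasing in $s>0$ for $i=1,2$ and decreasing in $s>0$ for at least one $i\in\{1,2\}$. Assume that $\lambda_1<0$, where $\lambda_1$ is the principal eigenvalue defined in the context. Then there exists at most one positive and bounded solution $p$ of the stationary problem (E) defined in the context. Furthermore, such a solution $p$, if any, is periodic and $\inf_{\mathbb R}p=\min_{\mathbb R}p>0$.
   Context: Setting. Fix constants $l_1,l_2,d_1,d_2,\sigma>0$ and put $l=l_1+l_2$. For $n\in\mathbb Z$, the open intervals $(nl-l_1,nl)$ are the patches of type 1 and the open intervals $(nl,nl+l_2)$ are the patches of type 2; a "patch" is any of these intervals. Put $S_1=l\mathbb Z$, $S_2=l_2+l\mathbb Z$ and $S=S_1\cup S_2$. For $x$ in a patch of type $i$ set $d(x)=d_i$, $f(x,s)=f_i(s)$ and $f_s(x,0)=f_i'(0)$. "Periodic" means $l$-periodic in $x$. Stationary problem (E): a solution is a continuous function $p:\mathbb R\to\mathbb R$ (not assumed periodic) with $p|_{\bar I}\in C^2(\bar I)$ for each patch $I$, such that $-d(x)p''(x)-f(x,p(x))=0$ for $x\in\mathbb R\setminus S$; $p(x^-)=p(x^+)$, $p'(x^-)=\sigma p'(x^+)$ for $x\in S_1$; $p(x^-)=p(x^+)$, $\sigma p'(x^-)=p'(x^+)$ for $x\in S_2$. Principal eigenvalue $\lambda_1$: the unique real number for which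 there is a (unique) continuous function $\phi:\mathbb R\to\mathbb R$ with $\phi|_{\bar I}\in C^\infty(\bar I)$ for each patch $I$, such that $-d(x)\phi''-f_s(x,0)\phi=\lambda_1\phi$ in $\mathbb R\setminus S$, $\phi'(x^-)=\sigma\phi'(x^+)$ for $x\in S_1$, $\sigma\phi'(x^-)=\phi'(x^+)$ for $x\in S_2$, $\phi$ is periodic, $\phi>0$ and $\|\phi\|_{L^\infty(\mathbb R)}=1$. *)

theory Defs
  imports "HOL-Analysis.Analysis"
begin

definition patches1 :: "real \<Rightarrow> real \<Rightarrow> real set set" where
  "patches1 l1 l2 = range (\<lambda>n::int. {of_int n * (l1 + l2) - l1 <..< of_int n * (l1 + l2)})"

definition patches2 :: "real \<Rightarrow> real \<Rightarrow> real set set" where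
  "patches2 l1 l2 = range (\<lambda>n::int. {of_int n * (l1 + l2) <..< of_int n * (l1 + l2) + l2})"

definition interfaces1 :: "real \<Rightarrow> real \<Rightarrow> real set" where
  "interfaces1 l1 l2 = range (\<lambda>n::int. of_int n * (l1 + l2))"

definition interfaces2 :: "real \<Rightarrow> real \<Rightarrow> real set" where
  "interfaces2 l1 l2 = range (\<lambda>n::int. l2 + of_int n * (l1 + l2))"

text \<open>A coefficient that takes the value \<open>a1\<close> on patches of type 1 and \<open>a2\<close> on patches of type 2.
  Every point off the interfaces lies in exactly one patch; the value given at interface points
  is arbitrary, and the equations below never refer to it.\<close>

definition patchwise :: "real \<Rightarrow> real \<Rightarrow> 'a \<Rightarrow> 'a \<Rightarrow> real \<Rightarrow> 'a" where
  "patchwise l1 l2 a1 a2 x = (if x \<in> \<Union> (patches1 l1 l2) then a1 else a2)"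

text \<open>Class \<open>C\<^sup>k\<close> on a set (used for closed intervals): the derivatives are taken within the set,
  hence are one-sided at the end points of an interval.\<close>

primrec Ck_on :: "nat \<Rightarrow> (real \<Rightarrow> real) \<Rightarrow> real set \<Rightarrow> bool" where
  "Ck_on 0 g A \<longleftrightarrow> continuous_on A g"
| "Ck_on (Suc k) g A \<longleftrightarrow>
     (\<exists>g'. (\<forall>x\<in>A. (g has_real_derivative g' x) (at x within A)) \<and> Ck_on k g' A)"

text \<open>\<open>left_val (deriv u) x\<close> and \<open>right_val (deriv u) x\<close> stand for $u'(x^-)$ and $u'(x^+)$. The limits
  exist at every interface point for all functions considered below, as these are at least
  \<open>C\<^sup>2\<close> on each closed patch.\<close>

definition left_val :: "(real \<Rightarrow> real) \<Rightarrow> real \<Rightarrow> real" where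
  "left_val g x = Lim (at_left x) g"

definition right_val :: "(real \<Rightarrow> real) \<Rightarrow> real \<Rightarrow> real" where
  "right_val g x = Lim (at_right x) g"

definition flux_conditions :: "real \<Rightarrow> real \<Rightarrow> real \<Rightarrow> (real \<Rightarrow> real) \<Rightarrow> bool" where
  "flux_conditions l1 l2 \<sigma> u \<longleftrightarrow>
     (\<forall>x\<in>interfaces1 l1 l2. left_val (deriv u) x = \<sigma> * right_val (deriv u) x) \<and>
     (\<forall>x\<in>interfaces2 l1 l2. \<sigma> * left_val (deriv u) x = right_val (deriv u) x)"

definition stationary_solution ::
  "real \<Rightarrow> real \<Rightarrow> real \<Rightarrow> real \<Rightarrow> real \<Rightarrow> (real \<Rightarrow> real) \<Rightarrow> (real \<Rightarrow> real) \<Rightarrow> (real \<Rightarrow> real) \<Rightarrow> bool" where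
  "stationary_solution l1 l2 d1 d2 \<sigma> f1 f2 p \<longleftrightarrow>
     continuous_on UNIV p \<and>
     (\<forall>I \<in> patches1 l1 l2 \<union> patches2 l1 l2. Ck_on 2 p (closure I)) \<and>
     (\<forall>x. x \<notin> interfaces1 l1 l2 \<union> interfaces2 l1 l2 \<longrightarrow>
        - patchwise l1 l2 d1 d2 x * deriv (deriv p) x - patchwise l1 l2 f1 f2 x (p x) = 0) \<and>
     (\<forall>x \<in> interfaces1 l1 l2 \<union> interfaces2 l1 l2. left_val p x = right_val p x) \<and>
     flux_conditions l1 l2 \<sigma> p"

definition periodic :: "real \<Rightarrow> (real \<Rightarrow> real) \<Rightarrow> bool" where
  "periodic l u \<longleftrightarrow> (\<forall>x. u (x + l) = u x)"

text \<open>The last condition is the normalisation of \<open>\<phi>\<close> in $L^\infty$: for a continuous periodic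
  function the essential supremum of the absolute value is the (finite) supremum.\<close>

definition principal_eigenfunction ::
  "real \<Rightarrow> real \<Rightarrow> real \<Rightarrow> real \<Rightarrow> real \<Rightarrow> (real \<Rightarrow> real) \<Rightarrow> (real \<Rightarrow> real) \<Rightarrow> real \<Rightarrow> (real \<Rightarrow> real) \<Rightarrow> bool" where
  "principal_eigenfunction l1 l2 d1 d2 \<sigma> f1 f2 lam \<phi> \<longleftrightarrow>
     continuous_on UNIV \<phi> \<and>
     (\<forall>I \<in> patches1 l1 l2 \<union> patches2 l1 l2. \<forall>k. Ck_on k \<phi> (closure I)) \<and>
     (\<forall>x. x \<notin> interfaces1 l1 l2 \<union> interfaces2 l1 l2 \<longrightarrow>
        - patchwise l1 l2 d1 d2 x * deriv (deriv \<phi>) x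
          - patchwise l1 l2 (deriv f1 0) (deriv f2 0) x * \<phi> x = lam * \<phi> x) \<and>
     flux_conditions l1 l2 \<sigma> \<phi> \<and>
     periodic (l1 + l2) \<phi> \<and>
     (\<forall>x. \<phi> x > 0) \<and>
     (SUP x. \<bar>\<phi> x\<bar>) = 1"

text \<open>Existence and uniqueness of such a \<open>lam\<close> (and of the normalised eigenfunction) are
  properties of the eigenvalue problem and are not part of the predicate.\<close>

definition principal_eigenvalue ::
  "real \<Rightarrow> real \<Rightarrow> real \<Rightarrow> real \<Rightarrow> real \<Rightarrow> (real \<Rightarrow> real) \<Rightarrow> (real \<Rightarrow> real) \<Rightarrow> real \<Rightarrow> bool" where
  "principal_eigenvalue l1 l2 d1 d2 \<sigma> f1 f2 lam \<longleftrightarrow>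
     (\<exists>\<phi>. principal_eigenfunction l1 l2 d1 d2 \<sigma> f1 f2 lam \<phi>)"

definition positive_bounded_solution ::
  "real \<Rightarrow> real \<Rightarrow> real \<Rightarrow> real \<Rightarrow> real \<Rightarrow> (real \<Rightarrow> real) \<Rightarrow> (real \<Rightarrow> real) \<Rightarrow> (real \<Rightarrow> real) \<Rightarrow> bool" where
  "positive_bounded_solution l1 l2 d1 d2 \<sigma> f1 f2 p \<longleftrightarrow>
     stationary_solution l1 l2 d1 d2 \<sigma> f1 f2 p \<and> (\<forall>x. p x > 0) \<and> bounded (range p)"

end

theory Submission
  imports Defs
begin

text \<open>In one dimension the problem reduces to an argument about Wronskians. Let \<open>w\<close> be \<open>1\<close> on
  patches of type 1 and \<open>\<sigma>\<close> on patches of type 2. The interface conditions say exactly that the flux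
  \<open>P = w p'\<close> of a solution \<open>p\<close> extends continuously across every interface, so \<open>p\<close> and \<open>P\<close> are
  continuous functions that solve a first-order system \<open>p' = a P\<close>, \<open>P' = - F x p\<close> off the
  interfaces, with \<open>a = 1 / w\<close> and \<open>F = w f / d\<close> (lemma \<open>flux_solution_of_piecewise_C2\<close>). The
  principal eigenfunction \<open>\<phi>\<close> solves such a system with a linear source \<open>L x * s\<close>.

  Let \<open>p\<close>, \<open>q\<close> be two positive bounded solutions, with fluxes \<open>P\<close>, \<open>Q\<close>, and put
  \<open>W = P q - p Q\<close>. Then \<open>(p / q)' = a W / q\<^sup>2\<close>, and
  \<open>W' = p F(q) - q F(p) = p q (F(q) / q - F(p) / p)\<close> is nonnegative where \<open>p > q\<close>, because \<open>F(s) / s\<close>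
  is non-increasing. Suppose that \<open>p > q\<close> and \<open>W > 0\<close> at some point. To the right of it the ratio
  increases, hence \<open>p > q\<close> persists, hence \<open>W\<close> stays above its initial value, and so \<open>p / q\<close> grows
  at least linearly. As \<open>p\<close> is bounded, \<open>q\<close> tends to \<open>0\<close> at \<open>+\<infinity>\<close>.

  No positive solution can do that, and this is where \<open>\<lambda>\<^sub>1 < 0\<close> enters: as \<open>F(s) / s\<close> exceeds
  \<open>L\<close> for small \<open>s\<close>, the Wronskian \<open>V\<close> of \<open>q\<close> and \<open>\<phi>\<close> is eventually non-increasing. If \<open>V\<close> is
  ever negative there, then \<open>q / \<phi>\<close> decreases at least linearly and becomes negative; otherwise
  \<open>q / \<phi>\<close> is eventually non-decreasing, which keeps \<open>q\<close> away from \<open>0\<close>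
  (lemma \<open>no_decay_at_top\<close>).

  Reflecting the line excludes \<open>W < 0\<close> in the same way, so \<open>W = 0\<close> wherever \<open>p > q\<close>, and by
  exchanging \<open>p\<close> and \<open>q\<close> wherever \<open>p \<noteq> q\<close>. This forces \<open>p / q\<close> to be constant. If the constant
  were not \<open>1\<close>, then \<open>W\<close> and \<open>W'\<close> would vanish identically, contradicting the strict monotonicity
  of \<open>F(s) / s\<close> on one type of patch (theorem \<open>bounded_positive_solution_unique\<close>).

  Uniqueness applied to \<open>p\<close> and its translate by one period shows that \<open>p\<close> is periodic, and a
  positive continuous periodic function attains a positive minimum.\<close>

section \<open>Systems for a function and its flux\<close>

text \<open>The form of the mean value inequality used throughout: the derivative may be missing at the
  interfaces, of which a compact interval contains finitely many.\<close>

lemma increment_ge_of_derivative_ge: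
  fixes g g' :: "real \<Rightarrow> real"
  assumes "finite (S \<inter> {a..b})" and "a \<le> b" and "continuous_on {a..b} g"
    and "\<And>x. \<lbrakk>a < x; x < b; x \<notin> S\<rbrakk> \<Longrightarrow> (g has_real_derivative g' x) (at x)"
    and "\<And>x. \<lbrakk>a < x; x < b; x \<notin> S\<rbrakk> \<Longrightarrow> m \<le> g' x"
  shows "m * (b - a) \<le> g b - g a"
proof -
  define h where "h x = (if x \<in> {a<..<b} - S then g' x else m)" for x
  have "(h has_integral (g b - g a)) {a..b}"
  proof (rule fundamental_theorem_of_calculus_interior_strong[OF assms(1,2) _ assms(3)])
    fix x assume "x \<in> {a<..<b} - S \<inter> {a..b}"
    then have "x \<in> {a<..<b} - S" by auto
    then show "(g has_vector_derivative h x) (at x)"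
      using assms(4)[of x] by (simp add: h_def has_real_derivative_iff_has_vector_derivative)
  qed
  moreover have "((\<lambda>x. m) has_integral (m * (b - a))) {a..b}"
    using has_integral_const_real[of m a b] assms(2) by (simp add: mult.commute)
  ultimately show ?thesis
    using has_integral_le[of "\<lambda>x. m" _ _ h] assms(5) by (simp add: h_def)
qed

text \<open>The source is a function of position and value, so that the nonlinear problem and its
  linearisation, in which the eigenvalue is absorbed, are instances of the same notion. On \<open>S\<close>, the
  continuity of the function and of its flux takes the place of the interface conditions.\<close>

definition flux_solution ::
  "real set \<Rightarrow> (real \<Rightarrow> real) \<Rightarrow> (real \<Rightarrow> real \<Rightarrow> real) \<Rightarrow> (real \<Rightarrow> real) \<Rightarrow> (real \<Rightarrow> real) \<Rightarrow> bool" where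
  "flux_solution S a F p P \<longleftrightarrow> continuous_on UNIV p \<and> continuous_on UNIV P \<and>
     (\<forall>x. x \<notin> S \<longrightarrow> (p has_real_derivative a x * P x) (at x) \<and>
                   (P has_real_derivative - F x (p x)) (at x))"

lemma flux_solution_continuous_on:
  assumes "flux_solution S a F p P"
  shows "continuous_on A p" "continuous_on A P"
  using assms continuous_on_subset unfolding flux_solution_def by blast+

lemma flux_solution_derivs:
  assumes "flux_solution S a F p P" and "x \<notin> S"
  shows "(p has_real_derivative a x * P x) (at x)" "(P has_real_derivative - F x (p x)) (at x)"
  using assms unfolding flux_solution_def by blast+

lemma flux_solution_uminus:
  assumes "flux_solution S a F p P"
  shows "flux_solution S a (\<lambda>x s. - F x (- s)) (\<lambda>x. - p x) (\<lambda>x. - P x)"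
  using assms unfolding flux_solution_def
  by (auto intro: continuous_on_minus derivative_eq_intros)

lemma flux_solution_reflect:
  assumes "flux_solution S a F p P"
  shows "flux_solution (uminus ` S) (\<lambda>x. a (- x)) (\<lambda>x. F (- x)) (\<lambda>x. p (- x)) (\<lambda>x. - P (- x))"
proof -
  have c: "continuous_on UNIV (\<lambda>x. p (- x))" "continuous_on UNIV (\<lambda>x. - P (- x))"
    by (intro continuous_intros continuous_on_compose2[OF flux_solution_continuous_on(1)[OF assms, of UNIV]]
        continuous_on_compose2[OF flux_solution_continuous_on(2)[OF assms, of UNIV]]; simp)+
  have d: "((\<lambda>x. p (- x)) has_real_derivative a (- x) * - P (- x)) (at x) \<and>
      ((\<lambda>x. - P (- x)) has_real_derivative - F (- x) (p (- x))) (at x)"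
    if "x \<notin> uminus ` S" for x
  proof -
    have "- x \<notin> S" using that by (metis imageI minus_minus)
    note D = flux_solution_derivs[OF assms this]
    show ?thesis
      using D(1)[unfolded DERIV_mirror] DERIV_minus[OF D(2)[unfolded DERIV_mirror]] by simp
  qed
  show ?thesis using c d unfolding flux_solution_def by blast
qed

lemma flux_solution_translate:
  assumes "flux_solution S a F p P"
    and "\<And>x. x + l \<in> S \<Longrightarrow> x \<in> S" and "\<And>x. x \<notin> S \<Longrightarrow> a (x + l) = a x"
    and "\<And>x. x \<notin> S \<Longrightarrow> F (x + l) = F x"
  shows "flux_solution S a F (\<lambda>x. p (x + l)) (\<lambda>x. P (x + l))"
proof -
  have c: "continuous_on UNIV (\<lambda>x. p (x + l))" "continuous_on UNIV (\<lambda>x. P (x + l))"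
    by (intro continuous_intros continuous_on_compose2[OF flux_solution_continuous_on(1)[OF assms(1), of UNIV]]
        continuous_on_compose2[OF flux_solution_continuous_on(2)[OF assms(1), of UNIV]]; simp)+
  have d: "((\<lambda>x. p (x + l)) has_real_derivative a x * P (x + l)) (at x) \<and>
      ((\<lambda>x. P (x + l)) has_real_derivative - F x (p (x + l))) (at x)"
    if "x \<notin> S" for x
  proof -
    have "x + l \<notin> S" using that assms(2) by blast
    note D = flux_solution_derivs[OF assms(1) this]
    show ?thesis using D assms(3,4)[OF that] by (simp add: DERIV_shift)
  qed
  show ?thesis using c d unfolding flux_solution_def by blast
qed

text \<open>The products of the two fluxes cancel, because both functions see the same coefficient \<open>a\<close>.
  What remains compares the two sources, and it has a sign whenever the ratios of source to value
  are ordered.\<close>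

lemma wronskian_derivative:
  assumes "flux_solution S a F p P" and "flux_solution S a G q Q" and "x \<notin> S"
  shows "((\<lambda>x. P x * q x - p x * Q x) has_real_derivative p x * G x (q x) - q x * F x (p x)) (at x)"
  using flux_solution_derivs[OF assms(1,3)] flux_solution_derivs[OF assms(2,3)]
  by (auto intro!: derivative_eq_intros simp: algebra_simps)

lemma ratio_derivative:
  assumes "flux_solution S a F p P" and "flux_solution S a G q Q" and "x \<notin> S" and "q x \<noteq> 0"
  shows "((\<lambda>x. p x / q x) has_real_derivative a x * (P x * q x - p x * Q x) / (q x)\<^sup>2) (at x)"
  using flux_solution_derivs[OF assms(1,3)] flux_solution_derivs[OF assms(2,3)] assms(4)
  by (auto intro!: derivative_eq_intros simp: field_simps power2_eq_square)

text \<open>A lower bound for the Wronskian is a lower bound for the slope of the ratio, because the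
  denominator is bounded. The numerator may have any sign, which allows a decreasing ratio to be
  treated by negating \<open>p\<close>.\<close>

lemma ratio_growth:
  assumes sols: "flux_solution S a F p P" "flux_solution S a G q Q"
    and fin: "\<And>u v. finite (S \<inter> {u..v})" and a0: "0 < a0" "\<And>x. a0 \<le> a x"
    and q: "\<And>x. 0 < q x" "\<And>x. q x \<le> B"
    and W: "\<And>x. \<lbrakk>x0 \<le> x; x \<le> y\<rbrakk> \<Longrightarrow> c \<le> P x * q x - p x * Q x" and c: "0 \<le> c" and xy: "x0 \<le> y"
  shows "p x0 / q x0 + a0 * c / B\<^sup>2 * (y - x0) \<le> p y / q y"
proof -
  have B: "0 < B" using q[of 0] by simp
  have "a0 * c / B\<^sup>2 * (y - x0) \<le> p y / q y - p x0 / q x0"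
  proof (rule increment_ge_of_derivative_ge[OF fin[of x0 y] xy])
    show "continuous_on {x0..y} (\<lambda>x. p x / q x)"
      using q(1) by (intro continuous_intros flux_solution_continuous_on[OF sols(1)]
          flux_solution_continuous_on[OF sols(2)]) (metis less_irrefl)
    fix x assume x: "x0 < x" "x < y" "x \<notin> S"
    show "((\<lambda>x. p x / q x) has_real_derivative a x * (P x * q x - p x * Q x) / (q x)\<^sup>2) (at x)"
      using ratio_derivative[OF sols x(3)] q(1)[of x] by simp
    have "a0 * c \<le> a x * (P x * q x - p x * Q x)"
      using a0 W[of x] x c by (intro mult_mono) (auto intro: order_trans[OF less_imp_le])
    moreover have "(q x)\<^sup>2 \<le> B\<^sup>2" using q[of x] by (intro power_mono) auto
    moreover have "0 \<le> a0 * c" using a0 c by simp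
    ultimately show "a0 * c / B\<^sup>2 \<le> a x * (P x * q x - p x * Q x) / (q x)\<^sup>2"
      using q(1)[of x] B by (intro frac_le) auto
  qed
  then show ?thesis by simp
qed

section \<open>Positive bounded solutions of a flux problem\<close>

text \<open>Assumption \<open>sub\<close> is the monotonicity of \<open>F x s / s\<close>, cleared of denominators. Assumption
  \<open>near0\<close> carries the sign of the principal eigenvalue \<open>\<lambda>\<^sub>1\<close>: there \<open>L\<close> is the linearised source
  shifted by \<open>\<lambda>\<^sub>1\<close>, and for \<open>\<lambda>\<^sub>1 < 0\<close> it lies below \<open>F\<close> near \<open>0\<close>. The setting is
  invariant under reflection of the line.\<close>

locale flux_problem =
  fixes S :: "real set" and a :: "real \<Rightarrow> real" and F :: "real \<Rightarrow> real \<Rightarrow> real"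
    and L \<phi> \<Phi> :: "real \<Rightarrow> real" and a0 \<mu> M \<delta> :: real
  assumes fin: "\<And>u v. finite (S \<inter> {u..v})"
    and a0: "0 < a0" "\<And>x. a0 \<le> a x"
    and sub: "\<And>x s t. \<lbrakk>x \<notin> S; 0 < s; s \<le> t\<rbrakk> \<Longrightarrow> s * F x t \<le> t * F x s"
    and eigen: "flux_solution S a (\<lambda>x s. L x * s) \<phi> \<Phi>"
    and \<phi>: "0 < \<mu>" "\<And>x. \<mu> \<le> \<phi> x" "\<And>x. \<phi> x \<le> M"
    and near0: "0 < \<delta>" "\<And>x s. \<lbrakk>x \<notin> S; 0 < s; s < \<delta>\<rbrakk> \<Longrightarrow> L x * s \<le> F x s"
begin

text \<open>Lets every statement about \<open>+\<infinity>\<close> be used at \<open>-\<infinity>\<close>. The flux, being a derivative, changes sign.\<close>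

lemma reflected:
  "flux_problem (uminus ` S) (\<lambda>x. a (- x)) (\<lambda>x. F (- x)) (\<lambda>x. L (- x)) (\<lambda>x. \<phi> (- x))
     (\<lambda>x. - \<Phi> (- x)) a0 \<mu> M \<delta>"
proof
  have mem: "- x \<notin> S" if "x \<notin> uminus ` S" for x using that by (metis imageI minus_minus)
  show "finite (uminus ` S \<inter> {u..v})" for u v :: real
  proof -
    have "uminus ` S \<inter> {u..v} = uminus ` (S \<inter> {-v..-u})" by force
    then show ?thesis using fin[of "-v" "-u"] by simp
  qed
  show "s * F (- x) t \<le> t * F (- x) s" if "x \<notin> uminus ` S" "0 < s" "s \<le> t" for x s t
    using sub[OF mem] that by blast
  show "L (- x) * s \<le> F (- x) s" if "x \<notin> uminus ` S" "0 < s" "s < \<delta>" for x s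
    using near0(2)[OF mem] that by blast
  show "flux_solution (uminus ` S) (\<lambda>x. a (- x)) (\<lambda>x s. L (- x) * s) (\<lambda>x. \<phi> (- x)) (\<lambda>x. - \<Phi> (- x))"
    using flux_solution_reflect[OF eigen] .
qed (use a0 \<phi> near0(1) in auto)

text \<open>While \<open>q\<close> is below \<open>\<delta>\<close>, its source dominates the linear one, so the Wronskian \<open>V\<close> with the
  eigenfunction cannot increase. Either sign of \<open>V\<close> is then incompatible with a positive \<open>q\<close> that
  tends to \<open>0\<close>.\<close>

lemma no_decay_at_top:
  assumes sol: "flux_solution S a F q Q" and pos: "\<And>x. 0 < q x"
  shows "\<not> (q \<longlongrightarrow> 0) at_top"
proof
  assume "(q \<longlongrightarrow> 0) at_top"
  then have lim: "eventually (\<lambda>x. q x < e) at_top" if "e > 0" for e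
    using that by (rule order_tendstoD(2))
  then obtain X where X: "\<And>x. x \<ge> X \<Longrightarrow> q x < \<delta>"
    using near0(1) by (meson eventually_at_top_linorder)
  have \<phi>pos: "0 < \<phi> x" for x using \<phi>(1) \<phi>(2)[of x] by simp
  define V where "V x = Q x * \<phi> x - q x * \<Phi> x" for x
  have V_mono: "V y \<le> V x" if "X \<le> x" "x \<le> y" for x y
  proof -
    have "0 * (y - x) \<le> (- V y) - (- V x)"
    proof (rule increment_ge_of_derivative_ge[OF fin \<open>x \<le> y\<close>])
      show "continuous_on {x..y} (\<lambda>x. - V x)" unfolding V_def
        by (intro continuous_intros flux_solution_continuous_on[OF sol] flux_solution_continuous_on[OF eigen])
      fix z assume z: "x < z" "z < y" "z \<notin> S"
      show "((\<lambda>x. - V x) has_real_derivative - (q z * (L z * \<phi> z) - \<phi> z * F z (q z))) (at z)"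
        unfolding V_def by (rule DERIV_minus[OF wronskian_derivative[OF sol eigen z(3)]])
      have "\<phi> z * (L z * q z) \<le> \<phi> z * F z (q z)"
        using near0(2)[OF z(3) pos X[of z]] z that \<phi>pos[of z] by (intro mult_left_mono) auto
      then show "0 \<le> - (q z * (L z * \<phi> z) - \<phi> z * F z (q z))" by (simp add: algebra_simps)
    qed
    then show ?thesis by simp
  qed
  show False
  proof (cases "\<exists>x1\<ge>X. V x1 < 0")
    case True
    then obtain x1 where x1: "x1 \<ge> X" "V x1 < 0" by blast
    define k where "k = a0 * (- V x1) / M\<^sup>2"
    have M: "0 < M" using \<phi>pos[of 0] \<phi>(3)[of 0] by simp
    have k: "k > 0" unfolding k_def using a0(1) x1(2) M by (intro divide_pos_pos mult_pos_pos) auto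
    \<comment> \<open>At \<open>y\<close> the linear upper bound for \<open>q / \<phi>\<close> with slope \<open>-k\<close> reaches zero.\<close>
    define y where "y = x1 + (q x1 / \<phi> x1) / k"
    have y: "x1 \<le> y" unfolding y_def using k pos[of x1] \<phi>pos[of x1] by simp
    have "- q x1 / \<phi> x1 + k * (y - x1) \<le> - q y / \<phi> y"
      unfolding k_def
    proof (rule ratio_growth[OF flux_solution_uminus[OF sol] eigen fin a0 \<phi>pos \<phi>(3) _ _ y])
      show "- V x1 \<le> - Q x * \<phi> x - - q x * \<Phi> x" if "x1 \<le> x" for x
        using V_mono[OF x1(1) that] unfolding V_def by simp
    qed (use x1 in simp)
    then have "0 \<le> - q y / \<phi> y" using k unfolding y_def by simp
    then show False using divide_pos_pos[OF pos[of y] \<phi>pos[of y]] by simp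
  next
    case False
    define e where "e = \<mu> * (q X / \<phi> X)"
    have e: "e > 0" unfolding e_def using \<phi>(1) \<phi>pos pos by simp
    have "e \<le> q y" if y: "X \<le> y" for y
    proof -
      have "q X / \<phi> X + a0 * 0 / M\<^sup>2 * (y - X) \<le> q y / \<phi> y"
        by (rule ratio_growth[OF sol eigen fin a0 \<phi>pos \<phi>(3) _ _ y])
          (use False in \<open>auto simp: V_def not_less\<close>)
      then have "\<phi> y * (q X / \<phi> X) \<le> q y" using \<phi>pos[of y] by (simp add: field_simps)
      moreover have "e \<le> \<phi> y * (q X / \<phi> X)" unfolding e_def
        using \<phi>(2)[of y] pos[of X] \<phi>pos[of X] by (intro mult_right_mono) auto
      ultimately show ?thesis by simp
    qed
    moreover obtain Y where "\<And>x. x \<ge> Y \<Longrightarrow> q x < e"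
      using lim[OF e] by (meson eventually_at_top_linorder)
    ultimately show False by (metis max.cobounded1 max.cobounded2 not_less)
  qed
qed

text \<open>A positive Wronskian at a point where \<open>p\<close> exceeds \<open>q\<close> sustains itself to the right: it makes
  the ratio \<open>p / q\<close> increase, so \<open>p > q\<close> is never lost, so the Wronskian does not decrease. The
  resulting linear growth of the ratio would drive \<open>q\<close> to \<open>0\<close>.\<close>

lemma wronskian_nonpos:
  assumes p: "flux_solution S a F p P" "\<And>x. 0 < p x" "\<And>x. p x \<le> B"
    and q: "flux_solution S a F q Q" "\<And>x. 0 < q x" "\<And>x. q x \<le> B"
    and x0: "q x0 < p x0"
  shows "P x0 * q x0 - p x0 * Q x0 \<le> 0"
proof (rule ccontr)
  define W where "W x = P x * q x - p x * Q x" for x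
  assume "\<not> P x0 * q x0 - p x0 * Q x0 \<le> 0"
  then have W0: "W x0 > 0" unfolding W_def by simp
  have W_cont: "continuous_on A W" for A unfolding W_def
    by (intro continuous_intros flux_solution_continuous_on[OF p(1)] flux_solution_continuous_on[OF q(1)])
  have W_mono: "W x0 \<le> W y" if y: "x0 \<le> y" and gt: "\<And>x. \<lbrakk>x0 \<le> x; x < y\<rbrakk> \<Longrightarrow> q x < p x" for y
  proof -
    have "0 * (y - x0) \<le> W y - W x0"
    proof (rule increment_ge_of_derivative_ge[OF fin y W_cont])
      fix x assume x: "x0 < x" "x < y" "x \<notin> S"
      show "(W has_real_derivative p x * F x (q x) - q x * F x (p x)) (at x)"
        unfolding W_def by (rule wronskian_derivative[OF p(1) q(1) x(3)])
      show "0 \<le> p x * F x (q x) - q x * F x (p x)"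
        using sub[OF x(3) q(2)[of x], of "p x"] gt[of x] x by simp
    qed
    then show ?thesis by simp
  qed
  have growth: "p x0 / q x0 + a0 * W x0 / B\<^sup>2 * (y - x0) \<le> p y / q y"
    if y: "x0 \<le> y" and gt: "\<And>x. \<lbrakk>x0 \<le> x; x < y\<rbrakk> \<Longrightarrow> q x < p x" for y
    by (rule ratio_growth[OF p(1) q(1) fin a0 q(2,3) _ _ y])
      (use W_mono gt W0 in \<open>auto simp: W_def\<close>)
  have B: "0 < B" using q(2,3)[of 0] by simp
  define k where "k = a0 * W x0 / B\<^sup>2"
  have k: "k > 0" unfolding k_def using a0 W0 B by simp
  have gt: "q y < p y" if "x0 \<le> y" for y
  proof (rule ccontr)
    \<comment> \<open>At the first point where \<open>p > q\<close> fails, the ratio would still be above its value at \<open>x0\<close>.\<close>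
    define Z where "Z = {x. x0 \<le> x \<and> p x \<le> q x}"
    assume "\<not> q y < p y"
    then have ne: "Z \<noteq> {}" using that unfolding Z_def by auto
    have bdd: "bdd_below Z" unfolding Z_def by (rule bdd_belowI[of _ x0]) auto
    have "closed Z" unfolding Z_def
      by (intro closed_Collect_conj closed_Collect_le continuous_intros
          flux_solution_continuous_on[OF p(1)] flux_solution_continuous_on[OF q(1)])
    then have Inf: "Inf Z \<in> Z" using closed_contains_Inf[OF ne bdd] by simp
    have "q x < p x" if "x0 \<le> x" "x < Inf Z" for x
      using that cInf_lower[OF _ bdd, of x] unfolding Z_def by force
    then have "p x0 / q x0 + k * (Inf Z - x0) \<le> p (Inf Z) / q (Inf Z)"
      using growth Inf unfolding Z_def k_def by blast
    moreover have "0 \<le> k * (Inf Z - x0)" using k Inf unfolding Z_def by simp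
    moreover have "1 < p x0 / q x0" using x0 q(2)[of x0] by simp
    moreover have "p (Inf Z) / q (Inf Z) \<le> 1" using Inf q(2)[of "Inf Z"] unfolding Z_def by simp
    ultimately show False by simp
  qed
  have "q y \<le> B / (1 + k * (y - x0))" if "x0 \<le> y" for y
  proof -
    have "1 + k * (y - x0) \<le> p y / q y"
      using growth[OF that] gt x0 q(2)[of x0] unfolding k_def
      by (smt (verit) less_divide_eq_1_pos)
    moreover have "0 < 1 + k * (y - x0)" using k that by (simp add: add_pos_nonneg)
    ultimately have "(1 + k * (y - x0)) * q y \<le> B" using q(2)[of y] p(3)[of y]
      by (simp add: pos_le_divide_eq)
    then show ?thesis using \<open>0 < 1 + k * (y - x0)\<close> by (simp add: pos_le_divide_eq mult.commute)
  qed
  then have le: "eventually (\<lambda>y. q y \<le> B / (1 + k * (y - x0))) at_top"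
    by (rule eventually_mono[OF eventually_ge_at_top[of x0]])
  have "filterlim (\<lambda>y. 1 + k * (y - x0)) at_top at_top"
    using k by (intro filterlim_tendsto_add_at_top[OF tendsto_const]
        filterlim_tendsto_pos_mult_at_top[OF tendsto_const])
      (auto intro: filterlim_tendsto_add_at_top[OF tendsto_const filterlim_ident, of "- x0", simplified])
  then have "((\<lambda>y. B / (1 + k * (y - x0))) \<longlongrightarrow> 0) at_top"
    by (intro tendsto_divide_0[OF tendsto_const] filterlim_at_top_imp_at_infinity)
  then have "(q \<longlongrightarrow> 0) at_top"
    by (intro tendsto_sandwich[OF _ le tendsto_const]) (simp_all add: less_imp_le q(2))
  with no_decay_at_top[OF q(1,2)] show False by blast
qed

text \<open>The Wronskian changes sign under reflection, so the one-sided bound becomes an equality.\<close>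

lemma wronskian_eq_0:
  assumes p: "flux_solution S a F p P" "\<And>x. 0 < p x" "\<And>x. p x \<le> B"
    and q: "flux_solution S a F q Q" "\<And>x. 0 < q x" "\<And>x. q x \<le> B"
    and x0: "q x0 < p x0"
  shows "P x0 * q x0 - p x0 * Q x0 = 0"
proof -
  interpret R: flux_problem "uminus ` S" "\<lambda>x. a (- x)" "\<lambda>x. F (- x)" "\<lambda>x. L (- x)" "\<lambda>x. \<phi> (- x)"
     "\<lambda>x. - \<Phi> (- x)" a0 \<mu> M \<delta> by (rule reflected)
  show ?thesis
    using wronskian_nonpos[OF assms]
      R.wronskian_nonpos[OF flux_solution_reflect[OF p(1)] p(2,3) flux_solution_reflect[OF q(1)] q(2,3),
        of "- x0"] x0
    by simp
qed

text \<open>A single point \<open>z\<close> of strict monotonicity suffices, because the ratio \<open>p / q\<close> is shown to be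
  constant on the whole line first.\<close>

theorem bounded_positive_solution_unique:
  assumes p: "flux_solution S a F p P" "\<And>x. 0 < p x" "\<And>x. p x \<le> B"
    and q: "flux_solution S a F q Q" "\<And>x. 0 < q x" "\<And>x. q x \<le> B"
    and z: "z \<notin> S" and strict: "\<And>s t. \<lbrakk>0 < s; s < t\<rbrakk> \<Longrightarrow> s * F z t < t * F z s"
  shows "p = q"
proof -
  define W where "W x = P x * q x - p x * Q x" for x
  have W0: "W x = 0" if "p x \<noteq> q x" for x
  proof (cases "q x < p x")
    case True
    then show ?thesis using wronskian_eq_0[OF p q] unfolding W_def by simp
  next
    case False
    then have "p x < q x" using that by simp
    then show ?thesis using wronskian_eq_0[OF q p] unfolding W_def by (simp add: algebra_simps)
  qed
  \<comment> \<open>By the square, the derivative of \<open>r\<close> has a factor that vanishes where \<open>p = q\<close>, which are the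
    points where nothing is known about \<open>W\<close>.\<close>
  define r where "r x = (p x / q x - 1)\<^sup>2" for x
  have dr: "(r has_real_derivative 0) (at x)" if x: "x \<notin> S" for x
  proof -
    have "q x \<noteq> 0" using q(2)[of x] by simp
    from DERIV_power[OF DERIV_diff[OF ratio_derivative[OF p(1) q(1) x this] DERIV_const], of 1 2]
    have "(r has_real_derivative 2 * (a x * W x / (q x)\<^sup>2 * (p x / q x - 1))) (at x)"
      unfolding r_def W_def by simp
    moreover have "(p x / q x - 1) * W x = 0" using W0[of x] \<open>q x \<noteq> 0\<close> by (cases "p x = q x") auto
    ultimately show ?thesis by (auto simp: mult_eq_0_iff)
  qed
  have rcont: "continuous_on A r" for A unfolding r_def
    using q(2) by (intro continuous_intros flux_solution_continuous_on[OF p(1)]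
          flux_solution_continuous_on[OF q(1)]) (metis less_irrefl)
  have mono: "r x \<le> r y \<and> r y \<le> r x" if "x \<le> y" for x y
  proof
    have "0 * (y - x) \<le> r y - r x"
      by (rule increment_ge_of_derivative_ge[OF fin that rcont, where g'="\<lambda>_. 0"]) (use dr in auto)
    then show "r x \<le> r y" by simp
    have "0 * (y - x) \<le> (- r y) - (- r x)"
      by (rule increment_ge_of_derivative_ge[OF fin that, where g'="\<lambda>_. 0"])
        (use DERIV_minus[OF dr] rcont in \<open>auto intro: continuous_on_minus\<close>)
    then show "r y \<le> r x" by simp
  qed
  then have rconst: "r x = r y" for x y by (meson antisym linear)
  have "r z = 0"
  proof (rule ccontr)
    assume "r z \<noteq> 0"
    then have "p x \<noteq> q x" for x using rconst[of x z] q(2)[of x] unfolding r_def by auto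
    with W0 have "W = (\<lambda>_. 0)" by blast
    then have "(W has_real_derivative 0) (at z)" by simp
    moreover have "(W has_real_derivative p z * F z (q z) - q z * F z (p z)) (at z)"
      unfolding W_def by (rule wronskian_derivative[OF p(1) q(1) z])
    ultimately have "p z * F z (q z) = q z * F z (p z)" using DERIV_unique by fastforce
    with strict[of "p z" "q z"] strict[of "q z" "p z"] p(2)[of z] q(2)[of z] \<open>p z \<noteq> q z\<close>
    show False by (metis less_irrefl linorder_neqE_linordered_idom)
  qed
  then have "r x = 0" for x using rconst[of x z] by simp
  moreover have "q x \<noteq> 0" for x using q(2)[of x] by simp
  ultimately show ?thesis by (simp add: r_def fun_eq_iff)
qed

end

section \<open>Functions on the line that are regular on each closed patch\<close>

text \<open>The derivatives taken within the closed interval are the continuous extensions of the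
  ordinary derivatives in the interior. Hence the one-sided limits that define \<open>left_val\<close> and
  \<open>right_val\<close> exist at the end points.\<close>

lemma C2_on_interval:
  assumes "Ck_on 2 u {c..d}" and "c < d"
  shows "\<And>x. \<lbrakk>c < x; x < d\<rbrakk> \<Longrightarrow> (u has_real_derivative deriv u x) (at x)"
    and "\<And>x. \<lbrakk>c < x; x < d\<rbrakk> \<Longrightarrow> (deriv u has_real_derivative deriv (deriv u) x) (at x)"
    and "(deriv u \<longlongrightarrow> left_val (deriv u) d) (at_left d)"
    and "(deriv u \<longlongrightarrow> right_val (deriv u) c) (at_right c)"
proof -
  obtain g g' where g: "\<And>x. x \<in> {c..d} \<Longrightarrow> (u has_real_derivative g x) (at x within {c..d})"
    and g': "\<And>x. x \<in> {c..d} \<Longrightarrow> (g has_real_derivative g' x) (at x within {c..d})"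
    using assms(1) unfolding numeral_2_eq_2 Ck_on.simps by metis
  have du: "(u has_real_derivative g x) (at x)" and dg: "(g has_real_derivative g' x) (at x)"
    if "c < x" "x < d" for x
    using g[of x] g'[of x] that by (simp_all add: at_within_Icc_at)
  have eq: "deriv u x = g x" if "c < x" "x < d" for x using DERIV_imp_deriv[OF du] that by blast
  show "(u has_real_derivative deriv u x) (at x)" if "c < x" "x < d" for x
    using du that eq by simp
  have ddu: "(deriv u has_real_derivative g' x) (at x)" if "c < x" "x < d" for x
    by (rule has_field_derivative_transform_within_open[OF dg[OF that], of "{c<..<d}"])
      (use that eq in auto)
  then show "(deriv u has_real_derivative deriv (deriv u) x) (at x)" if "c < x" "x < d" for x
    using DERIV_imp_deriv that by metis
  have cont: "continuous_on {c..d} g"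
    using DERIV_continuous[OF g'] by (simp add: continuous_on_eq_continuous_within)
  have "eventually (\<lambda>x. x \<in> {c<..<d}) (at_left d)" "eventually (\<lambda>x. x \<in> {c<..<d}) (at_right c)"
    using assms(2) eventually_at_left_real eventually_at_right_real by blast+
  then have ev: "eventually (\<lambda>x. g x = deriv u x) (at_left d)" "eventually (\<lambda>x. g x = deriv u x) (at_right c)"
    by (auto elim!: eventually_mono simp: eq)
  have "(g \<longlongrightarrow> g d) (at_left d)" "(g \<longlongrightarrow> g c) (at_right c)"
    using cont assms(2) unfolding continuous_on_def
    by (metis atLeastAtMost_iff at_within_Icc_at_left less_imp_le order_refl,
        metis atLeastAtMost_iff at_within_Icc_at_right less_imp_le order_refl)
  then have lim: "(deriv u \<longlongrightarrow> g d) (at_left d)" "(deriv u \<longlongrightarrow> g c) (at_right c)"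
    using Lim_transform_eventually ev by blast+
  have "left_val (deriv u) d = g d" "right_val (deriv u) c = g c"
    unfolding left_val_def right_val_def by (rule tendsto_Lim; simp add: lim)+
  then show "(deriv u \<longlongrightarrow> left_val (deriv u) d) (at_left d)"
    and "(deriv u \<longlongrightarrow> right_val (deriv u) c) (at_right c)" using lim by simp_all
qed

text \<open>Used for the flux, which is defined by its limits at the interfaces.\<close>

lemma continuous_on_of_limits_off_locally_finite:
  fixes v V :: "real \<Rightarrow> real"
  assumes "\<And>x. (v \<longlongrightarrow> V x) (at x)" and "\<And>x. x \<notin> S \<Longrightarrow> V x = v x"
    and "\<And>a b. finite (S \<inter> {a..b})"
  shows "continuous_on UNIV V"
proof -
  have "(V \<longlongrightarrow> V x) (at x)" for x
  proof (rule Lim_transform_eventually[OF assms(1)])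
    let ?T = "{x - 1<..<x + 1} - (S \<inter> {x - 1..x + 1} - {x})"
    have "open ?T" using assms(3) by (intro open_Diff finite_imp_closed) auto
    moreover have "x \<in> ?T" by simp
    moreover have "v y = V y" if "y \<in> ?T" "y \<noteq> x" for y using that assms(2)[of y] by auto
    ultimately show "eventually (\<lambda>y. v y = V y) (at x)" unfolding eventually_at_topological by blast
  qed
  then show ?thesis by (simp add: continuous_on_def)
qed

lemma continuous_periodic_attains_min:
  assumes "continuous_on UNIV u" and "periodic l u" and "0 < l"
  shows "\<exists>x0. \<forall>x. u x0 \<le> u x"
proof -
  interpret periodic_fun_simple u l using assms(2) by unfold_locales (simp add: periodic_def)
  have "continuous_on {0..l} u" using assms(1) continuous_on_subset by blast
  then obtain x0 where x0: "\<And>x. x \<in> {0..l} \<Longrightarrow> u x0 \<le> u x"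
    using continuous_attains_inf[of "{0..l}" u] assms(3) by (metis atLeastAtMost_iff compact_Icc empty_iff less_imp_le order_refl)
  have "u x0 \<le> u x" for x
  proof -
    have "x + of_int (- \<lfloor>x / l\<rfloor>) * l \<in> {0..l}"
      using assms(3) floor_divide_lower[of l x] floor_divide_upper[of l x] by (simp add: algebra_simps)
    from x0[OF this] show ?thesis unfolding plus_of_int .
  qed
  then show ?thesis by blast
qed

text \<open>With \<open>c = f'(0) + \<lambda>\<^sub>1\<close> this is the place where \<open>\<lambda>\<^sub>1 < 0\<close> is turned into a comparison of
  the nonlinear source with the linear one.\<close>

lemma linear_minorant_near_0:
  assumes "(f has_real_derivative D) (at 0)" and "f 0 = 0" and "c < D"
  shows "\<exists>\<delta>>0. \<forall>s. 0 < s \<and> s < \<delta> \<longrightarrow> c * s \<le> f s"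
proof -
  have "((\<lambda>s. f s / s) \<longlongrightarrow> D) (at 0)" using assms(1,2) by (simp add: DERIV_def)
  then have "eventually (\<lambda>s. c < f s / s) (at 0)" using assms(3) by (rule order_tendstoD(1))
  then obtain \<delta> where "\<delta> > 0" "\<And>s. \<lbrakk>s \<noteq> 0; dist s 0 < \<delta>\<rbrakk> \<Longrightarrow> c < f s / s"
    unfolding eventually_at by auto
  then have "c * s \<le> f s" if "0 < s" "s < \<delta>" for s
    using that by (metis abs_of_pos dist_0_norm dist_commute less_imp_le less_irrefl pos_less_divide_eq real_norm_def)
  with \<open>\<delta> > 0\<close> show ?thesis by blast
qed

section \<open>The periodic patch landscape\<close>

locale patch_landscape =
  fixes l1 l2 :: real
  assumes l1: "0 < l1" and l2: "0 < l2"
begin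

abbreviation S :: "real set" where
  "S \<equiv> interfaces1 l1 l2 \<union> interfaces2 l1 l2"

lemma l_pos: "0 < l1 + l2" using l1 l2 by simp

lemma finite_interfaces: "finite (S \<inter> {u..v})"
proof -
  let ?l = "l1 + l2"
  have "S \<inter> {u..v} \<subseteq> (\<lambda>n. of_int n * ?l) ` {\<lfloor>u / ?l\<rfloor>..\<lceil>v / ?l\<rceil>} \<union>
      (\<lambda>n. l2 + of_int n * ?l) ` {\<lfloor>(u - l2) / ?l\<rfloor>..\<lceil>(v - l2) / ?l\<rceil>}"
  proof
    fix x assume x: "x \<in> S \<inter> {u..v}"
    have bd: "n \<in> {\<lfloor>u' / ?l\<rfloor>..\<lceil>v' / ?l\<rceil>}" if "u' \<le> of_int n * ?l" "of_int n * ?l \<le> v'" for u' v' and n :: int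
    proof -
      have "u' / ?l \<le> of_int n" "of_int n \<le> v' / ?l" using that l_pos by (simp_all add: field_simps)
      then show ?thesis by (auto simp: floor_le_iff le_ceiling_iff)
    qed
    from x consider n where "x = of_int n * ?l" | n where "x = l2 + of_int n * ?l"
      unfolding interfaces1_def interfaces2_def by blast
    then show "x \<in> (\<lambda>n. of_int n * ?l) ` {\<lfloor>u / ?l\<rfloor>..\<lceil>v / ?l\<rceil>} \<union>
      (\<lambda>n. l2 + of_int n * ?l) ` {\<lfloor>(u - l2) / ?l\<rfloor>..\<lceil>(v - l2) / ?l\<rceil>}"
    proof cases
      case 1
      then show ?thesis using x bd[of u n v] by auto
    next
      case 2
      then show ?thesis using x bd[of "u - l2" n "v - l2"] by auto
    qed
  qed
  then show ?thesis by (rule finite_subset) auto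
qed

lemma patch_cases [consumes 1]:
  assumes "x \<notin> S"
  obtains (type1) n :: int where "of_int n * (l1 + l2) - l1 < x" "x < of_int n * (l1 + l2)"
    | (type2) n :: int where "of_int n * (l1 + l2) < x" "x < of_int n * (l1 + l2) + l2"
proof -
  define n where "n = \<lfloor>x / (l1 + l2)\<rfloor>"
  have n: "of_int n * (l1 + l2) \<le> x" "x < (of_int n + 1) * (l1 + l2)"
    unfolding n_def using l_pos floor_divide_lower floor_divide_upper by blast+
  have "x \<noteq> of_int n * (l1 + l2)" "x \<noteq> l2 + of_int n * (l1 + l2)"
    using assms unfolding interfaces1_def interfaces2_def by auto
  then consider "of_int n * (l1 + l2) < x" "x < of_int n * (l1 + l2) + l2"
    | "of_int (n + 1) * (l1 + l2) - l1 < x" "x < of_int (n + 1) * (l1 + l2)"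
    using n by (fastforce simp: algebra_simps)
  then show thesis using that by cases blast+
qed

lemma int_mult_l_less_iff: "of_int m * (l1 + l2) < of_int n * (l1 + l2) \<longleftrightarrow> m < n"
  using l_pos by simp

lemma int_mult_l_gap:
  assumes "(m::int) < n"
  shows "of_int m * (l1 + l2) + (l1 + l2) \<le> of_int n * (l1 + l2)"
proof -
  have "of_int (m + 1) * (l1 + l2) \<le> of_int n * (l1 + l2)"
    using assms l_pos by (intro mult_right_mono) auto
  then show ?thesis by (simp add: algebra_simps)
qed

lemma patch1_not_interface:
  assumes "of_int n * (l1 + l2) - l1 < x" "x < of_int n * (l1 + l2)"
  shows "x \<notin> S"
proof
  assume "x \<in> S"
  then consider m :: int where "x = of_int m * (l1 + l2)" | m :: int where "x = l2 + of_int m * (l1 + l2)"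
    unfolding interfaces1_def interfaces2_def by blast
  then show False
  proof cases
    case 1
    then have "m < n" using assms int_mult_l_less_iff by simp
    from int_mult_l_gap[OF this] show False using 1 assms l1 l2 by simp
  next
    case 2
    then have "of_int m * (l1 + l2) < of_int n * (l1 + l2)" using assms l2 by linarith
    then have "m < n" unfolding int_mult_l_less_iff .
    from int_mult_l_gap[OF this] show False using 2 assms l1 l2 by simp
  qed
qed

lemma patch2_not_interface:
  assumes "of_int n * (l1 + l2) < x" "x < of_int n * (l1 + l2) + l2"
  shows "x \<notin> S"
proof
  assume "x \<in> S"
  then consider m :: int where "x = of_int m * (l1 + l2)" | m :: int where "x = l2 + of_int m * (l1 + l2)"
    unfolding interfaces1_def interfaces2_def by blast
  then show False
  proof cases
    case 1
    then have "n < m" using assms int_mult_l_less_iff by simp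
    from int_mult_l_gap[OF this] show False using 1 assms l1 l2 by simp
  next
    case 2
    then have "of_int m * (l1 + l2) < of_int n * (l1 + l2)" using assms by linarith
    then have "m < n" unfolding int_mult_l_less_iff .
    from int_mult_l_gap[OF this] show False using 2 assms l1 l2 by simp
  qed
qed

lemma patchwise_on_patch1:
  assumes "of_int n * (l1 + l2) - l1 < x" "x < of_int n * (l1 + l2)"
  shows "patchwise l1 l2 a b x = a"
  using assms unfolding patchwise_def patches1_def by auto

lemma patchwise_on_patch2:
  assumes "of_int n * (l1 + l2) < x" "x < of_int n * (l1 + l2) + l2"
  shows "patchwise l1 l2 a b x = b"
proof -
  have False if m: "of_int m * (l1 + l2) - l1 < x" "x < of_int m * (l1 + l2)" for m :: int
  proof -
    have "of_int n * (l1 + l2) < of_int m * (l1 + l2)" using assms m by linarith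
    then have "n < m" unfolding int_mult_l_less_iff .
    from int_mult_l_gap[OF this] show False using m assms by simp
  qed
  then have "x \<notin> \<Union> (patches1 l1 l2)" unfolding patches1_def by auto
  then show ?thesis unfolding patchwise_def by simp
qed

lemma shift_interface: "x + (l1 + l2) \<in> S \<Longrightarrow> x \<in> S"
proof -
  assume "x + (l1 + l2) \<in> S"
  then consider m :: int where "x + (l1 + l2) = of_int m * (l1 + l2)"
    | m :: int where "x + (l1 + l2) = l2 + of_int m * (l1 + l2)"
    unfolding interfaces1_def interfaces2_def by blast
  then have "(\<exists>m::int. x = of_int m * (l1 + l2)) \<or> (\<exists>m::int. x = l2 + of_int m * (l1 + l2))"
  proof cases
    case (1 m)
    then have "x = of_int (m - 1) * (l1 + l2)" by (simp add: algebra_simps)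
    then show ?thesis by blast
  next
    case (2 m)
    then have "x = l2 + of_int (m - 1) * (l1 + l2)" by (simp add: algebra_simps)
    then show ?thesis by blast
  qed
  then show ?thesis unfolding interfaces1_def interfaces2_def by blast
qed

lemma patchwise_shift:
  assumes "x \<notin> S"
  shows "patchwise l1 l2 a b (x + (l1 + l2)) = patchwise l1 l2 a b x"
  using assms
proof (cases rule: patch_cases)
  case (type1 n)
  then have "of_int (n + 1) * (l1 + l2) - l1 < x + (l1 + l2)" "x + (l1 + l2) < of_int (n + 1) * (l1 + l2)"
    by (simp_all add: algebra_simps)
  with type1 show ?thesis by (simp only: patchwise_on_patch1)
next
  case (type2 n)
  then have "of_int (n + 1) * (l1 + l2) < x + (l1 + l2)" "x + (l1 + l2) < of_int (n + 1) * (l1 + l2) + l2"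
    by (simp_all add: algebra_simps)
  with type2 show ?thesis by (simp only: patchwise_on_patch2)
qed

text \<open>The weight turns both interface conditions into the statement that the one-sided limits of
  \<open>w u'\<close> agree. At an interface of the first kind the left patch has type 1 and the right one type 2;
  at the second kind it is the other way round. The flux is therefore defined as the two-sided
  limit, which exists at every point.\<close>

lemma flux_solution_of_piecewise_C2:
  assumes \<sigma>: "0 < \<sigma>"
    and cont: "continuous_on UNIV u"
    and C2: "\<forall>I \<in> patches1 l1 l2 \<union> patches2 l1 l2. Ck_on 2 u (closure I)"
    and flux: "flux_conditions l1 l2 \<sigma> u"
    and eq: "\<And>x. x \<notin> S \<Longrightarrow> patchwise l1 l2 1 \<sigma> x * deriv (deriv u) x = - F x (u x)"
  shows "\<exists>U. flux_solution S (patchwise l1 l2 1 (1 / \<sigma>)) F u U"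
proof -
  let ?w = "patchwise l1 l2 1 \<sigma>"
  define v where "v x = ?w x * deriv u x" for x
  define U where "U x = Lim (at x) v" for x
  have C2_1: "Ck_on 2 u {of_int n * (l1 + l2) - l1..of_int n * (l1 + l2)}" for n :: int
  proof -
    have "{of_int n * (l1 + l2) - l1<..<of_int n * (l1 + l2)} \<in> patches1 l1 l2"
      unfolding patches1_def by blast
    then have "Ck_on 2 u (closure {of_int n * (l1 + l2) - l1<..<of_int n * (l1 + l2)})"
      using C2 by blast
    then show ?thesis using l1 by simp
  qed
  have C2_2: "Ck_on 2 u {of_int n * (l1 + l2)..of_int n * (l1 + l2) + l2}" for n :: int
  proof -
    have "{of_int n * (l1 + l2)<..<of_int n * (l1 + l2) + l2} \<in> patches2 l1 l2"
      unfolding patches2_def by blast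
    then have "Ck_on 2 u (closure {of_int n * (l1 + l2)<..<of_int n * (l1 + l2) + l2})"
      using C2 by blast
    then show ?thesis using l2 by simp
  qed
  note patch1 = C2_on_interval[OF C2_1] and patch2 = C2_on_interval[OF C2_2]
  have off: "(u has_real_derivative deriv u x) (at x) \<and>
      (v has_real_derivative ?w x * deriv (deriv u) x) (at x)" if "x \<notin> S" for x
    using that
  proof (cases rule: patch_cases)
    case (type1 n)
    have "(v has_real_derivative deriv (deriv u) x) (at x)"
      using patch1(2)[of n x] type1 l1
      by (rule_tac has_field_derivative_transform_within_open[of "deriv u" _ _
            "{of_int n * (l1 + l2) - l1<..<of_int n * (l1 + l2)}"])
        (auto simp: v_def patchwise_on_patch1)
    then show ?thesis using patch1(1)[of n x] type1 l1 by (simp add: patchwise_on_patch1[OF type1])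
  next
    case (type2 n)
    have "(v has_real_derivative \<sigma> * deriv (deriv u) x) (at x)"
      using DERIV_cmult[OF patch2(2)[of n x], of \<sigma>] type2 l2
      by (rule_tac has_field_derivative_transform_within_open[of "\<lambda>x. \<sigma> * deriv u x" _ _
            "{of_int n * (l1 + l2)<..<of_int n * (l1 + l2) + l2}"])
        (auto simp: v_def patchwise_on_patch2)
    then show ?thesis using patch2(1)[of n x] type2 l2 by (simp add: patchwise_on_patch2[OF type2])
  qed
  have left1: "(v \<longlongrightarrow> left_val (deriv u) x) (at_left x)" if "x = of_int n * (l1 + l2)" for x and n :: int
  proof (rule Lim_transform_eventually)
    show "(deriv u \<longlongrightarrow> left_val (deriv u) x) (at_left x)" using patch1(3)[of n] l1 that by simp
    show "eventually (\<lambda>y. deriv u y = v y) (at_left x)"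
      using eventually_at_left_real[of "x - l1" x] l1 that
      by (auto elim!: eventually_mono simp: v_def patchwise_on_patch1)
  qed
  have right1: "(v \<longlongrightarrow> right_val (deriv u) x) (at_right x)"
    if "x = of_int n * (l1 + l2) - l1" for x and n :: int
  proof (rule Lim_transform_eventually)
    show "(deriv u \<longlongrightarrow> right_val (deriv u) x) (at_right x)" using patch1(4)[of n] l1 that by simp
    show "eventually (\<lambda>y. deriv u y = v y) (at_right x)"
      using eventually_at_right_real[of x "x + l1"] l1 that
      by (auto elim!: eventually_mono simp: v_def patchwise_on_patch1)
  qed
  have left2: "(v \<longlongrightarrow> \<sigma> * left_val (deriv u) x) (at_left x)"
    if "x = of_int n * (l1 + l2) + l2" for x and n :: int
  proof (rule Lim_transform_eventually)
    show "((\<lambda>y. \<sigma> * deriv u y) \<longlongrightarrow> \<sigma> * left_val (deriv u) x) (at_left x)"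
      using tendsto_mult_left[OF patch2(3)[of n]] l2 that by simp
    show "eventually (\<lambda>y. \<sigma> * deriv u y = v y) (at_left x)"
      using eventually_at_left_real[of "x - l2" x] l2 that
      by (auto elim!: eventually_mono simp: v_def patchwise_on_patch2)
  qed
  have right2: "(v \<longlongrightarrow> \<sigma> * right_val (deriv u) x) (at_right x)"
    if "x = of_int n * (l1 + l2)" for x and n :: int
  proof (rule Lim_transform_eventually)
    show "((\<lambda>y. \<sigma> * deriv u y) \<longlongrightarrow> \<sigma> * right_val (deriv u) x) (at_right x)"
      using tendsto_mult_left[OF patch2(4)[of n]] l2 that by simp
    show "eventually (\<lambda>y. \<sigma> * deriv u y = v y) (at_right x)"
      using eventually_at_right_real[of x "x + l2"] l2 that
      by (auto elim!: eventually_mono simp: v_def patchwise_on_patch2)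
  qed
  have "\<exists>L. (v \<longlongrightarrow> L) (at x)" for x
  proof -
    consider "x \<notin> S" | n :: int where "x = of_int n * (l1 + l2)" | n :: int where "x = l2 + of_int n * (l1 + l2)"
      unfolding interfaces1_def interfaces2_def by blast
    then show ?thesis
    proof cases
      case 1
      then show ?thesis using off DERIV_isCont isCont_def by blast
    next
      case (2 n)
      then have "left_val (deriv u) x = \<sigma> * right_val (deriv u) x"
        using flux unfolding flux_conditions_def interfaces1_def by blast
      then show ?thesis using left1[OF 2] right2[OF 2] filterlim_split_at_real by metis
    next
      case (3 n)
      then have "\<sigma> * left_val (deriv u) x = right_val (deriv u) x"
        using flux unfolding flux_conditions_def interfaces2_def by blast
      moreover have "x = of_int n * (l1 + l2) + l2" "x = of_int (n + 1) * (l1 + l2) - l1"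
        using 3 by (simp_all add: algebra_simps)
      ultimately show ?thesis using left2 right1 filterlim_split_at_real by metis
    qed
  qed
  then have lim: "(v \<longlongrightarrow> U x) (at x)" for x
    unfolding U_def using tendsto_Lim[OF trivial_limit_at] by metis
  have Uv: "U x = v x" if "x \<notin> S" for x
    using off[OF that] DERIV_isCont isCont_def tendsto_unique[OF trivial_limit_at lim] by blast
  have Ucont: "continuous_on UNIV U"
    by (rule continuous_on_of_limits_off_locally_finite[OF lim Uv finite_interfaces])
  have dU: "(U has_real_derivative - F x (u x)) (at x)" if x: "x \<notin> S" for x
  proof -
    have dv: "(v has_real_derivative - F x (u x)) (at x)" using off[OF x] eq[OF x] by simp
    let ?T = "{x - 1<..<x + 1} - (S \<inter> {x - 1..x + 1})"
    have "open ?T" using finite_interfaces by (intro open_Diff finite_imp_closed) auto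
    then show ?thesis
      by (rule has_field_derivative_transform_within_open[OF dv]) (use x Uv in auto)
  qed
  have "deriv u x = patchwise l1 l2 1 (1 / \<sigma>) x * U x" if x: "x \<notin> S" for x
    using Uv[OF x] \<sigma> by (simp add: v_def patchwise_def)
  then have "(u has_real_derivative patchwise l1 l2 1 (1 / \<sigma>) x * U x) (at x)" if "x \<notin> S" for x
    using off[OF that] that by simp
  then show ?thesis unfolding flux_solution_def using cont Ucont dU by blast
qed

end

section \<open>Uniqueness and periodicity of positive bounded stationary states\<close>

text \<open>The landscape with its nonlinear source \<open>F\<close>, eigenfunction \<open>\<phi>\<close> and shifted linear source \<open>L\<close> is a
  flux problem. The midpoint of a patch whose nonlinearity is the strict one serves as \<open>z\<close>.\<close>

theorem theorem2p4:
  fixes l1 l2 d1 d2 \<sigma> lam1 :: real and f1 f2 :: "real \<Rightarrow> real"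
  assumes "l1 > 0" and "l2 > 0" and "d1 > 0" and "d2 > 0" and "\<sigma> > 0"
    and "f1 C1_differentiable_on UNIV" and "f2 C1_differentiable_on UNIV"
    and "f1 0 = 0" and "f2 0 = 0"
    and "\<exists>K1>0. \<forall>s\<ge>K1. f1 s \<le> 0" and "\<exists>K2>0. \<forall>s\<ge>K2. f2 s \<le> 0"
    and "antimono_on {0<..} (\<lambda>s. f1 s / s)" and "antimono_on {0<..} (\<lambda>s. f2 s / s)"
    and "strict_antimono_on {0<..} (\<lambda>s. f1 s / s) \<or> strict_antimono_on {0<..} (\<lambda>s. f2 s / s)"
    and "principal_eigenvalue l1 l2 d1 d2 \<sigma> f1 f2 lam1" and "lam1 < 0"
  shows "(\<exists>\<^sub>\<le>\<^sub>1 p. positive_bounded_solution l1 l2 d1 d2 \<sigma> f1 f2 p) \<and>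
    (\<forall>p. positive_bounded_solution l1 l2 d1 d2 \<sigma> f1 f2 p \<longrightarrow>
       periodic (l1 + l2) p \<and>
       (\<exists>x0. (\<forall>x. p x0 \<le> p x) \<and> (INF x. p x) = p x0 \<and> p x0 > 0))"
proof -
  interpret patch_landscape l1 l2 using assms(1,2) by unfold_locales
  let ?a = "patchwise l1 l2 1 (1 / \<sigma>)"
  define F where "F = patchwise l1 l2 (\<lambda>s. f1 s / d1) (\<lambda>s. \<sigma> * f2 s / d2)"
  define L where "L = patchwise l1 l2 ((deriv f1 0 + lam1) / d1) (\<sigma> * (deriv f2 0 + lam1) / d2)"
  have d: "(f has_real_derivative deriv f 0) (at 0)" if "f C1_differentiable_on UNIV" for f :: "real \<Rightarrow> real"
  proof -
    have "f differentiable (at 0)"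
      using C1_diff_imp_diff[OF that] by (simp add: differentiable_on_def)
    then show ?thesis by (simp add: DERIV_deriv_iff_real_differentiable)
  qed
  obtain \<phi> where \<phi>: "principal_eigenfunction l1 l2 d1 d2 \<sigma> f1 f2 lam1 \<phi>"
    using assms(15) unfolding principal_eigenvalue_def by blast
  have \<phi>cont: "continuous_on UNIV \<phi>" and \<phi>per: "periodic (l1 + l2) \<phi>" and \<phi>pos: "\<And>x. 0 < \<phi> x"
    using \<phi> unfolding principal_eigenfunction_def by blast+
  have "\<exists>\<Phi>. flux_solution S ?a (\<lambda>x s. L x * s) \<phi> \<Phi>"
  proof (rule flux_solution_of_piecewise_C2[OF assms(5) \<phi>cont])
    show "patchwise l1 l2 1 \<sigma> x * deriv (deriv \<phi>) x = - (L x * \<phi> x)" if x: "x \<notin> S" for x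
    proof -
      have "- patchwise l1 l2 d1 d2 x * deriv (deriv \<phi>) x
          - patchwise l1 l2 (deriv f1 0) (deriv f2 0) x * \<phi> x = lam1 * \<phi> x"
        using \<phi> x unfolding principal_eigenfunction_def by blast
      moreover have "patchwise l1 l2 d1 d2 x \<noteq> 0" using assms(3,4) by (simp add: patchwise_def)
      ultimately have "deriv (deriv \<phi>) x =
          - ((patchwise l1 l2 (deriv f1 0) (deriv f2 0) x + lam1) * \<phi> x) / patchwise l1 l2 d1 d2 x"
        by (simp add: eq_divide_eq algebra_simps)
      then show ?thesis by (simp add: L_def patchwise_def)
    qed
  qed (use \<phi> in \<open>auto simp: principal_eigenfunction_def\<close>)
  then obtain \<Phi> where \<Phi>: "flux_solution S ?a (\<lambda>x s. L x * s) \<phi> \<Phi>" by blast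
  obtain y0 where y0: "\<And>x. \<phi> y0 \<le> \<phi> x"
    using continuous_periodic_attains_min[OF \<phi>cont \<phi>per l_pos] by blast
  obtain y1 where y1: "\<And>x. - \<phi> y1 \<le> - \<phi> x"
    using continuous_periodic_attains_min[of "\<lambda>x. - \<phi> x" "l1 + l2"] \<phi>cont \<phi>per l_pos
    by (auto simp: periodic_def intro: continuous_on_minus)
  obtain \<delta>1 where \<delta>1: "\<delta>1 > 0" "\<And>s. \<lbrakk>0 < s; s < \<delta>1\<rbrakk> \<Longrightarrow> (deriv f1 0 + lam1) * s \<le> f1 s"
    using linear_minorant_near_0[OF d[OF assms(6)] assms(8), of "deriv f1 0 + lam1"] assms(16) by auto
  obtain \<delta>2 where \<delta>2: "\<delta>2 > 0" "\<And>s. \<lbrakk>0 < s; s < \<delta>2\<rbrakk> \<Longrightarrow> (deriv f2 0 + lam1) * s \<le> f2 s"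
    using linear_minorant_near_0[OF d[OF assms(7)] assms(9), of "deriv f2 0 + lam1"] assms(16) by auto
  interpret flux_problem S ?a F L \<phi> \<Phi> "min 1 (1 / \<sigma>)" "\<phi> y0" "\<phi> y1" "min \<delta>1 \<delta>2"
  proof
    show "finite (S \<inter> {u..v})" for u v by (rule finite_interfaces)
    show "0 < min 1 (1 / \<sigma>)" using assms(5) by simp
    show "min 1 (1 / \<sigma>) \<le> ?a x" for x by (simp add: patchwise_def)
    show "s * F x t \<le> t * F x s" if "x \<notin> S" and st: "0 < s" "s \<le> t" for x s t
    proof -
      have "f1 t / t \<le> f1 s / s" "f2 t / t \<le> f2 s / s"
        using assms(12,13) st unfolding monotone_on_def by auto
      then have "s * f1 t \<le> t * f1 s" "s * f2 t \<le> t * f2 s" using st by (simp_all add: field_simps)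
      then have "s * f1 t / d1 \<le> t * f1 s / d1" "\<sigma> * (s * f2 t) / d2 \<le> \<sigma> * (t * f2 s) / d2"
        using assms(3-5) by (auto intro!: divide_right_mono)
      then show ?thesis unfolding F_def patchwise_def by (simp add: mult_ac)
    qed
    show "flux_solution S ?a (\<lambda>x s. L x * s) \<phi> \<Phi>" by (rule \<Phi>)
    show "0 < \<phi> y0" "\<phi> y0 \<le> \<phi> x" "\<phi> x \<le> \<phi> y1" for x using \<phi>pos y0 y1[of x] by auto
    show "0 < min \<delta>1 \<delta>2" using \<delta>1 \<delta>2 by simp
    show "L x * s \<le> F x s" if "x \<notin> S" "0 < s" "s < min \<delta>1 \<delta>2" for x s
    proof -
      have "(deriv f1 0 + lam1) * s / d1 \<le> f1 s / d1"
        "\<sigma> * ((deriv f2 0 + lam1) * s) / d2 \<le> \<sigma> * f2 s / d2"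
        using \<delta>1(2)[of s] \<delta>2(2)[of s] that assms(3-5) by (auto intro!: divide_right_mono)
      then show ?thesis unfolding F_def L_def patchwise_def by (simp add: mult_ac)
    qed
  qed
  obtain z where z: "z \<notin> S" "\<And>s t. \<lbrakk>0 < s; s < t\<rbrakk> \<Longrightarrow> s * F z t < t * F z s"
  proof -
    have key: "s * f t < t * f s"
      if "strict_antimono_on {0<..} (\<lambda>s. f s / s)" "0 < s" "s < t" for f :: "real \<Rightarrow> real" and s t
    proof -
      have "f t / t < f s / s" using that unfolding monotone_on_def by auto
      then show ?thesis using that by (simp add: field_simps)
    qed
    from assms(14) show thesis
    proof
      assume *: "strict_antimono_on {0<..} (\<lambda>s. f1 s / s)"
      have z: "of_int 0 * (l1 + l2) - l1 < - l1 / 2" "- l1 / 2 < of_int 0 * (l1 + l2)" using l1 by simp_all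
      show thesis
      proof (rule that[OF patch1_not_interface[OF z]])
        show "s * F (- l1 / 2) t < t * F (- l1 / 2) s" if "0 < s" "s < t" for s t
          using key[OF * that] assms(3) unfolding F_def patchwise_on_patch1[OF z]
          by (simp add: divide_strict_right_mono)
      qed
    next
      assume *: "strict_antimono_on {0<..} (\<lambda>s. f2 s / s)"
      have z: "of_int 0 * (l1 + l2) < l2 / 2" "l2 / 2 < of_int 0 * (l1 + l2) + l2" using l2 by simp_all
      show thesis
      proof (rule that[OF patch2_not_interface[OF z]])
        show "s * F (l2 / 2) t < t * F (l2 / 2) s" if "0 < s" "s < t" for s t
        proof -
          have "\<sigma> * (s * f2 t) / d2 < \<sigma> * (t * f2 s) / d2"
            using key[OF * that] assms(4,5) by (intro divide_strict_right_mono) auto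
          then show ?thesis unfolding F_def patchwise_on_patch2[OF z] by (simp add: mult_ac)
        qed
      qed
    qed
  qed
  have sol: "\<exists>P. flux_solution S ?a F p P" and pos: "\<And>x. 0 < p x" and bdd: "\<exists>B. \<forall>x. p x \<le> B"
    if p: "positive_bounded_solution l1 l2 d1 d2 \<sigma> f1 f2 p" for p
  proof -
    have st: "stationary_solution l1 l2 d1 d2 \<sigma> f1 f2 p"
      using p unfolding positive_bounded_solution_def by blast
    show "\<exists>P. flux_solution S ?a F p P"
    proof (rule flux_solution_of_piecewise_C2[OF assms(5)])
      show "patchwise l1 l2 1 \<sigma> x * deriv (deriv p) x = - F x (p x)" if x: "x \<notin> S" for x
      proof -
        have "patchwise l1 l2 d1 d2 x * deriv (deriv p) x = - patchwise l1 l2 f1 f2 x (p x)"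
          using st x unfolding stationary_solution_def by force
        then show ?thesis
          using assms(3,4) unfolding F_def
          by (cases "x \<in> \<Union> (patches1 l1 l2)") (simp_all add: patchwise_def field_simps)
      qed
    qed (use st in \<open>auto simp: stationary_solution_def\<close>)
    show "0 < p x" for x using p unfolding positive_bounded_solution_def by blast
    have "bounded (range p)" using p unfolding positive_bounded_solution_def by blast
    then show "\<exists>B. \<forall>x. p x \<le> B" unfolding bounded_iff by (auto dest: abs_le_D1)
  qed
  have uniq: "p = q"
    if "flux_solution S ?a F p P" "\<And>x. 0 < p x" "\<And>x. p x \<le> A"
      "flux_solution S ?a F q Q" "\<And>x. 0 < q x" "\<And>x. q x \<le> B" for p P q Q A B
  proof (rule bounded_positive_solution_unique[OF that(1,2) _ that(4,5) _ z])
    show "p x \<le> max A B" "q x \<le> max A B" for x using that(3)[of x] that(6)[of x] by auto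
  qed
  have "\<exists>\<^sub>\<le>\<^sub>1 p. positive_bounded_solution l1 l2 d1 d2 \<sigma> f1 f2 p"
    unfolding Uniq_def using sol pos bdd uniq by metis
  moreover have "periodic (l1 + l2) p \<and> (\<exists>x0. (\<forall>x. p x0 \<le> p x) \<and> (INF x. p x) = p x0 \<and> p x0 > 0)"
    if p: "positive_bounded_solution l1 l2 d1 d2 \<sigma> f1 f2 p" for p
  proof -
    obtain P B where P: "flux_solution S ?a F p P" and B: "\<And>x. p x \<le> B" using sol[OF p] bdd[OF p] by blast
    have "flux_solution S ?a F (\<lambda>x. p (x + (l1 + l2))) (\<lambda>x. P (x + (l1 + l2)))"
      by (rule flux_solution_translate[OF P shift_interface]) (simp_all add: F_def patchwise_shift)
    then have "(\<lambda>x. p (x + (l1 + l2))) = p"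
      by (rule uniq[OF _ _ _ P]) (rule pos[OF p] B)+
    then have per: "periodic (l1 + l2) p"
      unfolding periodic_def by (simp add: fun_eq_iff)
    obtain x0 where x0: "\<And>x. p x0 \<le> p x"
      using continuous_periodic_attains_min[OF flux_solution_continuous_on(1)[OF P] per l_pos] by blast
    then have "(INF x. p x) = p x0" by (intro cInf_eq_minimum) auto
    with per x0 pos[OF p] show ?thesis by blast
  qed
  ultimately show ?thesis by blast
qed

end
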